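(* Let $\mathbf{z}_t = \begin{bmatrix} x_t \\ y_t \end{bmatrix} \in \mathbb{R}^2$ ($t\in\mathbb{Z}$) be a stable bivariate VAR($p$) process, $p\ge 1$, $$\mathbf{z}_t = A_1 \mathbf{z}_{t-1} + \cdots + A_p \mathbf{z}_{t-p} + \epsilon_t, \qquad \Sigma = \langle \epsilon_t\epsilon_t^\top\rangle = \begin{bmatrix} \Sigma_{xx} & \Sigma_{xy} \\ \Sigma_{xy} & \Sigma_{yy}\end{bmatrix},$$ with time-reversed representation $$\mathbf{z}_t = \tilde{A}_1 \mathbf{z}_{t+1} + \cdots + \tilde{A}_p \mathbf{z}_{t+p} + \tilde{\epsilon}_t, \qquad \tilde{\Sigma} = \langle \tilde{\epsilon}_t\tilde{\epsilon}_t^\top\rangle = \begin{bmatrix} \tilde{\Sigma}_{xx} & \tilde{\Sigma}_{xy} \\ \tilde{\Sigma}_{xy} & \tilde{\Sigma}_{yy}\end{bmatrix}.$$ Assume that (A1) $A_1,\ldots,A_p$ are lower triangular matrices; (A2) $\Sigma$ is a diagonal matrix, i.e. $\Sigma_{xy}=0$; (A3) $C_{\mathbf{z}}(0)$ is invertible. Then $$\tilde{\Sigma}_{xx} \leq \Sigma_{xx} \qquad\text{and}\qquad \tilde{\Sigma}_{yy} \geq \Sigma_{yy}.$$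
   Context: $\langle\cdot\rangle$ denotes expectation. For a stationary process $\mathbf{z}_t$ the cross-covariance matrices are $C_{\mathbf{z}}(h) = \big\langle (\mathbf{z}_t - \langle \mathbf{z}\rangle)(\mathbf{z}_{t-h} - \langle\mathbf{z}\rangle)^\top\big\rangle$, $h\in\mathbb{Z}$. Stable VAR($p$) process: $A_1,\ldots,A_p\in\mathbb{R}^{2\times 2}$ satisfy $\det(I - A_1\lambda - \cdots - A_p\lambda^p)\neq 0$ for all $\lambda\in\mathbb{C}$ with $|\lambda|\le 1$, and $\mathbf{z}_t$ is the (second-order) stationary process satisfying the recursion. The innovations (residuals) $\epsilon_t\in\mathbb{R}^2$ are white noise: they form a stationary process with finite covariance, $\langle\epsilon_t\rangle=0$, $\langle\epsilon_t\epsilon_{t-h}^\top\rangle=0$ for all $h\in\mathbb{Z}\setminus\{0\}$, and moreover $\langle\epsilon_t\mathbf{z}_{t-h}^\top\rangle=0$ for all integers $h\ge 1$. Neither independence nor Gaussianity of the $\epsilon_t$ is assumed, and the residual covariance $\Sigma$ is in general not assumed diagonal. Time-reversed representation: the time-reversed process $\tilde{\mathbf{z}}_t := \mathbf{z}_{-t}$ has again a VAR($p$) representation (a known result of Andel), written as $\mathbf{z}_t = \tilde{A}_1 \mathbf{z}_{t+1} + \cdots + \tilde{A}_p \mathbf{z}_{t+p} + \tilde{\epsilon}_t$, where $\tilde{\epsilon}_t$ is white noise (mean zero, $\langle\tilde{\epsilon}_t\tilde{\epsilon}_{t-h}^\top\rangle=0$ for $h\in\mathbb{Z}\setminus\{0\}$)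 with $\langle\tilde{\epsilon}_t\mathbf{z}_{t+h}^\top\rangle=0$ for all integers $h\ge 1$; its residual covariance matrix is $\tilde{\Sigma}=\langle\tilde{\epsilon}_t\tilde{\epsilon}_t^\top\rangle$. The entries of $\Sigma$ and $\tilde\Sigma$ are indexed by $x$ (first coordinate) and $y$ (second coordinate). *)

theory Defs
  imports "HOL-Probability.Probability"
begin

text \<open>
  A bivariate process is a family \<open>z :: int \<Rightarrow> 'a \<Rightarrow> real^2\<close> of random vectors on a probability
  space \<open>M\<close>; component 1 is the coordinate \<open>x\<close> and component 2 the coordinate \<open>y\<close>. Expectations
  of vectors and matrices are Bochner integrals.
\<close>

definition outer_product :: "real^'m \<Rightarrow> real^'n \<Rightarrow> real^'n^'m" where
  "outer_product u v = (\<chi> i j. u $ i * v $ j)"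

definition lagged_cov :: "'a measure \<Rightarrow> (int \<Rightarrow> 'a \<Rightarrow> real^'n) \<Rightarrow> int \<Rightarrow> int \<Rightarrow> real^'n^'n" where
  "lagged_cov M z t h =
     (LINT \<omega>|M. outer_product (z t \<omega> - (LINT \<omega>'|M. z t \<omega>'))
                             (z (t - h) \<omega> - (LINT \<omega>'|M. z (t - h) \<omega>')))"

definition second_order_stationary :: "'a measure \<Rightarrow> (int \<Rightarrow> 'a \<Rightarrow> real^'n) \<Rightarrow> bool" where
  "second_order_stationary M z \<longleftrightarrow>
     (\<forall>t. z t \<in> borel_measurable M \<and> integrable M (\<lambda>\<omega>. (norm (z t \<omega>))\<^sup>2)) \<and>
     (\<exists>\<mu>. \<forall>t. (LINT \<omega>|M. z t \<omega>) = \<mu>) \<and>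
     (\<exists>C. \<forall>t h. lagged_cov M z t h = C h)"

text \<open>
  For a stationary process the next two quantities do not depend on the reference time,
  which is taken to be 0.
\<close>

definition cross_cov :: "'a measure \<Rightarrow> (int \<Rightarrow> 'a \<Rightarrow> real^'n) \<Rightarrow> int \<Rightarrow> real^'n^'n" where
  "cross_cov M z h = lagged_cov M z 0 h"

definition residual_cov :: "'a measure \<Rightarrow> (int \<Rightarrow> 'a \<Rightarrow> real^'n) \<Rightarrow> real^'n^'n" where
  "residual_cov M e = (LINT \<omega>|M. outer_product (e 0 \<omega>) (e 0 \<omega>))"

definition white_noise :: "'a measure \<Rightarrow> (int \<Rightarrow> 'a \<Rightarrow> real^'n) \<Rightarrow> bool" where
  "white_noise M e \<longleftrightarrow>
     second_order_stationary M e \<and>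
     (\<forall>t. (LINT \<omega>|M. e t \<omega>) = 0) \<and>
     (\<forall>t h. h \<noteq> 0 \<longrightarrow> (LINT \<omega>|M. outer_product (e t \<omega>) (e (t - h) \<omega>)) = 0)"

definition stable_coeffs :: "nat \<Rightarrow> (nat \<Rightarrow> real^'n^'n) \<Rightarrow> bool" where
  "stable_coeffs p A \<longleftrightarrow>
     (\<forall>l::complex. cmod l \<le> 1 \<longrightarrow>
        det (mat 1 - (\<Sum>i=1..p. map_matrix (\<lambda>a. complex_of_real a * l ^ i) (A i))) \<noteq> 0)"

definition stable_VAR ::
  "'a measure \<Rightarrow> nat \<Rightarrow> (nat \<Rightarrow> real^'n^'n) \<Rightarrow> (int \<Rightarrow> 'a \<Rightarrow> real^'n) \<Rightarrow> (int \<Rightarrow> 'a \<Rightarrow> real^'n) \<Rightarrow> bool" where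
  "stable_VAR M p A z e \<longleftrightarrow>
     stable_coeffs p A \<and>
     second_order_stationary M z \<and>
     white_noise M e \<and>
     (\<forall>t. AE \<omega> in M. z t \<omega> = (\<Sum>i=1..p. A i *v z (t - int i) \<omega>) + e t \<omega>) \<and>
     (\<forall>t h. h \<ge> 1 \<longrightarrow> (LINT \<omega>|M. outer_product (e t \<omega>) (z (t - h) \<omega>)) = 0)"

definition time_reversed_VAR ::
  "'a measure \<Rightarrow> nat \<Rightarrow> (nat \<Rightarrow> real^'n^'n) \<Rightarrow> (int \<Rightarrow> 'a \<Rightarrow> real^'n) \<Rightarrow> (int \<Rightarrow> 'a \<Rightarrow> real^'n) \<Rightarrow> bool" where
  "time_reversed_VAR M p A z e \<longleftrightarrow>
     white_noise M e \<and>
     (\<forall>t. AE \<omega> in M. z t \<omega> = (\<Sum>i=1..p. A i *v z (t + int i) \<omega>) + e t \<omega>) \<and>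
     (\<forall>t h. h \<ge> 1 \<longrightarrow> (LINT \<omega>|M. outer_product (e t \<omega>) (z (t + h) \<omega>)) = 0)"

text \<open>
  Written out by entries because in the index type \<open>2\<close> the numeral \<open>2\<close> equals \<open>0\<close>, so \<open>2 < 1\<close>
  holds there and the order of the type does not match the row and column order.
\<close>

definition lower_triangular2 :: "real^2^2 \<Rightarrow> bool" where
  "lower_triangular2 A \<longleftrightarrow> A $ 1 $ 2 = 0"

definition diagonal_matrix :: "real^'n^'n \<Rightarrow> bool" where
  "diagonal_matrix A \<longleftrightarrow> (\<forall>i j. i \<noteq> j \<longrightarrow> A $ i $ j = 0)"

end

theory Submission
  imports Defs
begin

text \<open>
  By (A1) and (A2), \<open>x\<close> is a scalar autoregression that drives \<open>y\<close> without feedback, and the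
  innovations of the two components are uncorrelated. Both inequalities come from the fact that
  a scalar stationary family has the same forecast and backcast errors
  (\<open>prediction_error_time_reversal\<close>), together with a comparison of what is available as
  predictor in the two directions of time.

  For \<open>x\<close>: the forward residual variance is the error of predicting \<open>x\<close> from the past of \<open>x\<close>
  alone, hence also the error of backcasting \<open>x\<close> with the same coefficients from the future of
  \<open>x\<close> alone. The reversed representation uses the best predictor from the future of both
  components, so its error is no larger.

  For \<open>y\<close>: heuristically, remove from \<open>y\<close> its projection onto all of \<open>x\<close>, past and future. What
  remains is again a scalar autoregression, driven by the innovations of \<open>y\<close> only, whose forecast
  error, and hence backcast error, is \<open>\<Sigma>\<^bsub>yy\<^esub>\<close>. Backcasting \<open>y\<close> from the future of
  both components has less information than backcasting from the future of \<open>y\<close> and all of \<open>x\<close>,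
  so its error is no smaller.

  The second argument is carried out without constructing the projection, as follows. The
  innovations of \<open>y\<close> are orthogonal to \<open>x\<close> at all times
  (\<open>driven_innovation_orthogonal_driver\<close>), and their inner products with \<open>y\<close> give a causal
  sequence \<open>G\<close> that depends on the time difference alone (\<open>impulse_response_shift\<close>). By Bessel's
  inequality \<open>G\<close> is square-summable, and the norm of the backcast error of \<open>y\<close> is bounded below
  by that of a combination of translates of \<open>G\<close>, up to the factor \<open>\<Sigma>\<^bsub>yy\<^esub>\<close>.
  Reversing time in \<open>\<ell>\<^sup>2(\<int>)\<close> turns this into a combination of the same norm in which the
  entry at time 0 is exactly \<open>G 0 = \<Sigma>\<^bsub>yy\<^esub>\<close>
  (\<open>causal_sequence_backcast_bound\<close>).
\<close>

section \<open>Square-integrable functions and their inner product\<close>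

definition sq_integrable :: "'a measure \<Rightarrow> ('a \<Rightarrow> real) \<Rightarrow> bool" where
  "sq_integrable M f \<longleftrightarrow> f \<in> borel_measurable M \<and> integrable M (\<lambda>\<omega>. (f \<omega>)\<^sup>2)"

definition L2_inner :: "'a measure \<Rightarrow> ('a \<Rightarrow> real) \<Rightarrow> ('a \<Rightarrow> real) \<Rightarrow> real" where
  "L2_inner M f g = (LINT \<omega>|M. f \<omega> * g \<omega>)"

lemma sq_integrable_mult:
  assumes "sq_integrable M f" "sq_integrable M g"
  shows "integrable M (\<lambda>\<omega>. f \<omega> * g \<omega>)"
proof (rule Bochner_Integration.integrable_bound)
  show "integrable M (\<lambda>\<omega>. (f \<omega>)\<^sup>2 + (g \<omega>)\<^sup>2)"
    using assms unfolding sq_integrable_def by auto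
  show "(\<lambda>\<omega>. f \<omega> * g \<omega>) \<in> borel_measurable M"
    using assms unfolding sq_integrable_def by auto
  have "\<bar>u * v\<bar> \<le> u\<^sup>2 + v\<^sup>2" for u v :: real
    using sum_squares_bound[of "\<bar>u\<bar>" "\<bar>v\<bar>"] mult_nonneg_nonneg[OF abs_ge_zero[of u] abs_ge_zero[of v]]
    unfolding abs_mult power2_abs by linarith
  then show "AE \<omega> in M. norm (f \<omega> * g \<omega>) \<le> norm ((f \<omega>)\<^sup>2 + (g \<omega>)\<^sup>2)"
    by simp
qed

lemma sq_integrable_zero: "sq_integrable M (\<lambda>\<omega>. 0)"
  by (simp add: sq_integrable_def)

lemma sq_integrable_cmult: "sq_integrable M f \<Longrightarrow> sq_integrable M (\<lambda>\<omega>. c * f \<omega>)"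
  by (auto simp: sq_integrable_def power_mult_distrib)

lemma sq_integrable_add:
  assumes "sq_integrable M f" "sq_integrable M g"
  shows "sq_integrable M (\<lambda>\<omega>. f \<omega> + g \<omega>)"
proof -
  have "integrable M (\<lambda>\<omega>. (f \<omega>)\<^sup>2 + (g \<omega>)\<^sup>2 + 2 * (f \<omega> * g \<omega>))"
    using assms sq_integrable_mult[OF assms] unfolding sq_integrable_def by auto
  then show ?thesis
    using assms unfolding sq_integrable_def by (auto simp: power2_sum mult.assoc)
qed

lemma sq_integrable_diff:
  assumes "sq_integrable M f" "sq_integrable M g"
  shows "sq_integrable M (\<lambda>\<omega>. f \<omega> - g \<omega>)"
  using sq_integrable_add[OF assms(1) sq_integrable_cmult[OF assms(2), of "-1"]] by simp

lemma sq_integrable_sum: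
  assumes "\<And>i. i \<in> I \<Longrightarrow> sq_integrable M (f i)"
  shows "sq_integrable M (\<lambda>\<omega>. \<Sum>i\<in>I. f i \<omega>)"
proof (cases "finite I")
  case True
  then show ?thesis
    using assms by (induction I) (auto intro: sq_integrable_add sq_integrable_zero)
qed (simp add: sq_integrable_zero)

lemmas sq_integrable_intros =
  sq_integrable_add sq_integrable_diff sq_integrable_cmult sq_integrable_sum

lemma L2_inner_commute: "L2_inner M f g = L2_inner M g f"
  by (simp add: L2_inner_def mult.commute)

lemma L2_inner_self_nonneg: "0 \<le> L2_inner M f f"
  by (simp add: L2_inner_def)

lemma L2_inner_cong_AE:
  assumes "AE \<omega> in M. g \<omega> = g' \<omega>" "sq_integrable M f" "sq_integrable M g" "sq_integrable M g'"
  shows "L2_inner M f g = L2_inner M f g'"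
  unfolding L2_inner_def
  by (rule integral_cong_AE) (use assms in \<open>auto simp: sq_integrable_def\<close>)

lemma L2_inner_cmult: "L2_inner M f (\<lambda>\<omega>. c * g \<omega>) = c * L2_inner M f g"
proof -
  have "(\<lambda>\<omega>. f \<omega> * (c * g \<omega>)) = (\<lambda>\<omega>. c * (f \<omega> * g \<omega>))"
    by (simp add: fun_eq_iff)
  then show ?thesis
    by (simp add: L2_inner_def)
qed

lemma L2_inner_add:
  assumes "sq_integrable M f" "sq_integrable M g" "sq_integrable M h"
  shows "L2_inner M f (\<lambda>\<omega>. g \<omega> + h \<omega>) = L2_inner M f g + L2_inner M f h"
  using sq_integrable_mult[OF assms(1,2)] sq_integrable_mult[OF assms(1,3)]
  by (simp add: L2_inner_def distrib_left)

lemma L2_inner_diff: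
  assumes "sq_integrable M f" "sq_integrable M g" "sq_integrable M h"
  shows "L2_inner M f (\<lambda>\<omega>. g \<omega> - h \<omega>) = L2_inner M f g - L2_inner M f h"
  using sq_integrable_mult[OF assms(1,2)] sq_integrable_mult[OF assms(1,3)]
  by (simp add: L2_inner_def right_diff_distrib)

lemma L2_inner_sum:
  assumes "sq_integrable M f" "\<And>i. i \<in> I \<Longrightarrow> sq_integrable M (g i)"
  shows "L2_inner M f (\<lambda>\<omega>. \<Sum>i\<in>I. g i \<omega>) = (\<Sum>i\<in>I. L2_inner M f (g i))"
  unfolding L2_inner_def sum_distrib_left
  by (rule Bochner_Integration.integral_sum) (use assms sq_integrable_mult in blast)

lemma L2_inner_linear_combination:
  assumes "sq_integrable M f" "\<And>i. i \<in> I \<Longrightarrow> sq_integrable M (g i)"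
  shows "L2_inner M f (\<lambda>\<omega>. \<Sum>i\<in>I. c i * g i \<omega>) = (\<Sum>i\<in>I. c i * L2_inner M f (g i))"
  using assms by (subst L2_inner_sum) (auto simp: sq_integrable_cmult L2_inner_cmult)

text \<open>Pythagoras: adding an orthogonal component can only increase the norm.\<close>

lemma L2_inner_self_le_orthogonal_sum:
  assumes "sq_integrable M u" "sq_integrable M v" "sq_integrable M w"
    and w: "AE \<omega> in M. w \<omega> = u \<omega> + v \<omega>"
    and orth: "L2_inner M u v = 0"
  shows "L2_inner M u u \<le> L2_inner M w w"
proof -
  have uv: "sq_integrable M (\<lambda>\<omega>. u \<omega> + v \<omega>)"
    using assms by (intro sq_integrable_intros)
  have "L2_inner M w w = L2_inner M w (\<lambda>\<omega>. u \<omega> + v \<omega>)"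
    by (rule L2_inner_cong_AE) (use assms uv in auto)
  also have "\<dots> = L2_inner M u w + L2_inner M v w"
    using assms by (simp add: L2_inner_add L2_inner_commute)
  also have "L2_inner M u w = L2_inner M u (\<lambda>\<omega>. u \<omega> + v \<omega>)"
    by (rule L2_inner_cong_AE) (use assms uv in auto)
  also have "L2_inner M v w = L2_inner M v (\<lambda>\<omega>. u \<omega> + v \<omega>)"
    by (rule L2_inner_cong_AE) (use assms uv in auto)
  finally have "L2_inner M w w = L2_inner M u u + L2_inner M v v"
    using assms orth L2_inner_commute[of M u v] by (simp add: L2_inner_add)
  then show ?thesis
    using L2_inner_self_nonneg[of M v] by simp
qed

text \<open>
  Expand \<open>0 \<le> \<parallel>s f - P\<parallel>\<^sup>2\<close>, where \<open>P\<close> is \<open>s\<close> times the projection of \<open>f\<close> onto the span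
  of the family. Leaving the family unnormalised suits innovations, whose variance is \<open>s\<close>.
\<close>

lemma bessel_inequality:
  assumes "sq_integrable M f" "\<And>j. j \<in> J \<Longrightarrow> sq_integrable M (e j)" "finite J" "s > 0"
    and orth: "\<And>j k. j \<in> J \<Longrightarrow> k \<in> J \<Longrightarrow> L2_inner M (e j) (e k) = (if j = k then s else 0)"
  shows "(\<Sum>j\<in>J. (L2_inner M (e j) f)\<^sup>2) \<le> s * L2_inner M f f"
proof -
  define c where "c j = L2_inner M (e j) f" for j
  define P where "P = (\<lambda>\<omega>. \<Sum>j\<in>J. c j * e j \<omega>)"
  define S where "S = (\<Sum>j\<in>J. (c j)\<^sup>2)"
  have P: "sq_integrable M P"
    unfolding P_def using assms by (intro sq_integrable_intros)
  have sf: "sq_integrable M (\<lambda>\<omega>. s * f \<omega>)"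
    using assms by (intro sq_integrable_intros)
  have fP: "L2_inner M f P = S"
    unfolding P_def S_def using L2_inner_linear_combination[OF assms(1,2), where c = c]
    by (simp add: L2_inner_commute[of M f] c_def power2_eq_square)
  have eP: "L2_inner M P (e j) = s * c j" if "j \<in> J" for j
  proof -
    have "L2_inner M (e j) P = (\<Sum>k\<in>J. c k * (if j = k then s else 0))"
      unfolding P_def using assms that by (simp add: L2_inner_linear_combination cong: sum.cong)
    also have "\<dots> = s * c j"
      using \<open>finite J\<close> that by (simp add: if_distrib[of "(*) _"] cong: if_cong)
    finally show ?thesis
      by (simp add: L2_inner_commute)
  qed
  have PP: "L2_inner M P P = s * S"
  proof -
    have "L2_inner M P P = (\<Sum>j\<in>J. c j * L2_inner M P (e j))"
      using L2_inner_linear_combination[OF P, of J e c] assms unfolding P_def by simp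
    also have "\<dots> = (\<Sum>j\<in>J. c j * (s * c j))"
      by (simp add: eP)
    also have "\<dots> = s * S"
      by (simp add: S_def sum_distrib_left power2_eq_square algebra_simps)
    finally show ?thesis .
  qed
  let ?d = "\<lambda>\<omega>. s * f \<omega> - P \<omega>"
  have d: "sq_integrable M ?d"
    by (rule sq_integrable_diff[OF sf P])
  have "L2_inner M ?d ?d = s * L2_inner M f ?d - L2_inner M P ?d"
    using L2_inner_diff[OF d sf P] by (simp add: L2_inner_cmult L2_inner_commute[of M ?d f] L2_inner_commute[of M ?d P])
  also have "\<dots> = s * (s * L2_inner M f f - S) - (s * S - s * S)"
    using assms sf P fP PP by (simp add: L2_inner_diff L2_inner_cmult L2_inner_commute[of M P f])
  finally have "0 \<le> s * (s * L2_inner M f f - S)"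
    using L2_inner_self_nonneg[of M ?d] by simp
  then show ?thesis
    using \<open>s > 0\<close> by (simp add: zero_le_mult_iff S_def c_def)
qed

text \<open>
  Counting measure makes \<open>\<ell>\<^sup>2\<close> an instance of the inner product above, so that the reversal
  of time can be applied to random variables and to sequences alike.
\<close>

lemma sq_integrable_count_space_bounded:
  assumes "\<And>F. finite F \<Longrightarrow> (\<Sum>m\<in>F. (g m)\<^sup>2) \<le> B"
  shows "sq_integrable (count_space UNIV) g" "L2_inner (count_space UNIV) g g \<le> B"
proof -
  have s: "(\<lambda>m. (g m)\<^sup>2) summable_on UNIV"
    using assms by (intro nonneg_bdd_above_summable_on) (auto simp: bdd_above_def)
  then have "Infinite_Set_Sum.abs_summable_on (\<lambda>m. (g m)\<^sup>2) UNIV"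
    by (subst abs_summable_equivalent[symmetric]) simp
  then have i: "integrable (count_space UNIV) (\<lambda>m. (g m)\<^sup>2)"
    by (simp add: abs_summable_on_def)
  then show "sq_integrable (count_space UNIV) g"
    by (simp add: sq_integrable_def)
  have "L2_inner (count_space UNIV) g g = infsetsum (\<lambda>m. (g m)\<^sup>2) UNIV"
    by (simp add: L2_inner_def infsetsum_def power2_eq_square)
  also have "\<dots> = infsum (\<lambda>m. (g m)\<^sup>2) UNIV"
    using i by (intro infsetsum_infsum) (simp add: abs_summable_on_def)
  also have "\<dots> \<le> B"
    by (rule infsum_le_finite_sums[OF s]) (use assms in auto)
  finally show "L2_inner (count_space UNIV) g g \<le> B" .
qed

lemma L2_inner_count_space_ge:
  assumes "sq_integrable (count_space UNIV) g"
  shows "(g a)\<^sup>2 \<le> L2_inner (count_space UNIV) g g"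
proof -
  have i: "Infinite_Set_Sum.abs_summable_on (\<lambda>m. (g m)\<^sup>2) UNIV"
    using assms by (simp add: abs_summable_on_def sq_integrable_def)
  then have s: "(\<lambda>m. (g m)\<^sup>2) summable_on UNIV"
    by (subst (asm) abs_summable_equivalent[symmetric]) simp
  have "(g a)\<^sup>2 \<le> infsum (\<lambda>m. (g m)\<^sup>2) UNIV"
    using finite_sum_le_infsum[OF s, of "{a}"] by simp
  also have "\<dots> = L2_inner (count_space UNIV) g g"
    using infsetsum_infsum[OF i] by (simp add: L2_inner_def infsetsum_def power2_eq_square)
  finally show ?thesis .
qed

section \<open>Time reversal for scalar stationary families\<close>

text \<open>
  A real autocovariance function is even, so the Gram matrix of a stationary family is unchanged
  when time is reversed. Forecasting and backcasting with the same coefficients therefore have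
  the same error. This is particular to scalar processes: for vectors,
  reversal transposes the autocovariances.
\<close>

lemma prediction_error_time_reversal:
  fixes f :: "int \<Rightarrow> 'b \<Rightarrow> real"
  assumes sq: "\<And>t. sq_integrable M (f t)"
    and stat: "\<And>s t. L2_inner M (f s) (f t) = r (s - t)"
  shows "L2_inner M (\<lambda>\<omega>. f 0 \<omega> - (\<Sum>i=1..p. c i * f (int i) \<omega>))
                    (\<lambda>\<omega>. f 0 \<omega> - (\<Sum>i=1..p. c i * f (int i) \<omega>))
       = L2_inner M (\<lambda>\<omega>. f 0 \<omega> - (\<Sum>i=1..p. c i * f (- int i) \<omega>))
                    (\<lambda>\<omega>. f 0 \<omega> - (\<Sum>i=1..p. c i * f (- int i) \<omega>))"
proof -
  \<comment> \<open>Absorb the predicted value as the term of lag 0, so that the error is a single sum.\<close>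
  define d where "d i = (if i = 0 then 1 else - c i)" for i :: nat
  have eq: "(\<lambda>\<omega>. f 0 \<omega> - (\<Sum>i=1..p. c i * f (g i) \<omega>)) = (\<lambda>\<omega>. \<Sum>i=0..p. d i * f (g i) \<omega>)"
    if "g 0 = 0" for g :: "nat \<Rightarrow> int"
    using that by (simp add: fun_eq_iff sum.atLeast_Suc_atMost[of 0 p] d_def sum_negf)
  have expand: "L2_inner M (\<lambda>\<omega>. \<Sum>i=0..p. d i * f (g i) \<omega>) (\<lambda>\<omega>. \<Sum>i=0..p. d i * f (g i) \<omega>)
      = (\<Sum>i=0..p. \<Sum>k=0..p. d i * (d k * r (g i - g k)))" for g
  proof -
    let ?w = "\<lambda>\<omega>. \<Sum>i=0..p. d i * f (g i) \<omega>"
    have w: "sq_integrable M ?w"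
      using sq by (intro sq_integrable_intros)
    have "L2_inner M ?w ?w = (\<Sum>i=0..p. d i * L2_inner M (f (g i)) ?w)"
      by (subst L2_inner_linear_combination[OF w]) (use sq in \<open>auto simp: L2_inner_commute[of M ?w]\<close>)
    also have "\<dots> = (\<Sum>i=0..p. \<Sum>k=0..p. d i * (d k * r (g i - g k)))"
      using sq by (simp add: L2_inner_linear_combination sum_distrib_left stat)
    finally show ?thesis .
  qed
  have even: "r (- n) = r n" for n
    using stat[of 0 n] stat[of n 0] L2_inner_commute[of M "f 0"] by simp
  have rev: "r (- int i - - int k) = r (int i - int k)" for i k
    using even[of "int i - int k"] by simp
  have id_0: "int 0 = 0" and neg_0: "- int 0 = 0"
    by simp_all
  show ?thesis
    unfolding eq[of int, OF id_0] eq[of "\<lambda>i. - int i", OF neg_0] expand rev ..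
qed

text \<open>
  The same reversal applied to the translates of a square-summable sequence, which form a
  stationary family in \<open>\<ell>\<^sup>2(\<int>)\<close>. For a causal sequence, the reversed combination of translates
  has the entry \<open>G 0\<close> at time 0, whatever the coefficients.
\<close>

lemma causal_sequence_backcast_bound:
  fixes G :: "int \<Rightarrow> real"
  assumes sq: "sq_integrable (count_space UNIV) G"
    and causal: "\<And>n. n < 0 \<Longrightarrow> G n = 0"
  shows "(G 0)\<^sup>2 \<le> L2_inner (count_space UNIV) (\<lambda>m. G m - (\<Sum>i=1..p. c i * G (m + int i)))
                                                (\<lambda>m. G m - (\<Sum>i=1..p. c i * G (m + int i)))"
proof -
  define f where "f t m = G (m + t)" for t m :: int
  have bij: "bij (\<lambda>m::int. m + t)" for t
    by (rule bij_plus_right)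
  have sqf: "sq_integrable (count_space UNIV) (f t)" for t
    using integrable_bij_count_space[OF bij[of t], of "\<lambda>m. (G m)\<^sup>2"] sq
    by (simp add: sq_integrable_def f_def)
  have stat: "L2_inner (count_space UNIV) (f s) (f t)
      = L2_inner (count_space UNIV) (f (s - t)) (f 0)" for s t
    using integral_bij_count_space[OF bij[of t], of "\<lambda>m. G (m + (s - t)) * G m"]
    by (simp add: L2_inner_def f_def)
  let ?u = "\<lambda>m. f 0 m - (\<Sum>i=1..p. c i * f (int i) m)"
  let ?v = "\<lambda>m. f 0 m - (\<Sum>i=1..p. c i * f (- int i) m)"
  have "(G 0)\<^sup>2 = (?v 0)\<^sup>2"
    using causal by (simp add: f_def)
  also have "\<dots> \<le> L2_inner (count_space UNIV) ?v ?v"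
    by (intro L2_inner_count_space_ge sq_integrable_intros sqf)
  also have "\<dots> = L2_inner (count_space UNIV) ?u ?u"
    by (rule prediction_error_time_reversal[symmetric, where f = f]) (rule sqf, rule stat)
  finally show ?thesis
    by (simp add: f_def)
qed

section \<open>The driven component\<close>

text \<open>
  What triangular coefficients and a diagonal residual covariance leave of the bivariate process:
  \<open>x\<close> drives \<open>y\<close> without feedback, and no innovation of \<open>y\<close> is correlated with one of \<open>x\<close>.
\<close>

locale driven_pair =
  fixes M :: "'a measure" and p :: nat
    and a b c :: "nat \<Rightarrow> real"
    and x y ex ey :: "int \<Rightarrow> 'a \<Rightarrow> real"
    and s :: real
  assumes sq_int: "\<And>t. sq_integrable M (x t)" "\<And>t. sq_integrable M (y t)"
      "\<And>t. sq_integrable M (ex t)" "\<And>t. sq_integrable M (ey t)"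
    and x_eq: "\<And>t. AE \<omega> in M. x t \<omega> = (\<Sum>i=1..p. a i * x (t - int i) \<omega>) + ex t \<omega>"
    and y_eq: "\<And>t. AE \<omega> in M. y t \<omega> = (\<Sum>i=1..p. c i * x (t - int i) \<omega>)
                                      + (\<Sum>i=1..p. b i * y (t - int i) \<omega>) + ey t \<omega>"
    and ey_ex: "\<And>t u. L2_inner M (ey t) (ex u) = 0"
    and ey_ey: "\<And>t u. L2_inner M (ey t) (ey u) = (if t = u then s else 0)"
    and ey_past: "\<And>t u. u < t \<Longrightarrow> L2_inner M (ey t) (x u) = 0"
      "\<And>t u. u < t \<Longrightarrow> L2_inner M (ey t) (y u) = 0"
begin

text \<open>
  Future values of \<open>x\<close> are made of past ones and of innovations of \<open>x\<close> only, so the innovations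
  of \<open>y\<close> stay orthogonal to \<open>x\<close> at all times.
\<close>

lemma driven_innovation_orthogonal_driver: "L2_inner M (ey t) (x u) = 0"
proof (induction "nat (u - t + 1)" arbitrary: u rule: less_induct)
  case less
  show ?case
  proof (cases "u < t")
    case True
    then show ?thesis by (rule ey_past)
  next
    case False
    have "L2_inner M (ey t) (x u)
        = L2_inner M (ey t) (\<lambda>\<omega>. (\<Sum>i=1..p. a i * x (u - int i) \<omega>) + ex u \<omega>)"
      by (rule L2_inner_cong_AE[OF x_eq]) (intro sq_integrable_intros sq_int)+
    also have "\<dots> = (\<Sum>i=1..p. a i * L2_inner M (ey t) (x (u - int i))) + L2_inner M (ey t) (ex u)"
      by (simp add: L2_inner_add L2_inner_linear_combination sq_int sq_integrable_intros)
    also have "\<dots> = 0"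
      using False by (simp add: less ey_ex)
    finally show ?thesis .
  qed
qed

text \<open>
  The response of \<open>y\<close> to its own innovation obeys a recursion with constant coefficients in
  which \<open>x\<close> does not appear, so it depends on the time difference only.
\<close>

lemma impulse_response_shift: "L2_inner M (ey t) (y u) = L2_inner M (ey 0) (y (u - t))"
proof (induction "nat (u - t + 1)" arbitrary: u rule: less_induct)
  case less
  show ?case
  proof (cases "u < t")
    case True
    then show ?thesis by (simp add: ey_past)
  next
    case False
    have step: "L2_inner M (ey t) (y u)
        = (\<Sum>i=1..p. b i * L2_inner M (ey t) (y (u - int i))) + L2_inner M (ey t) (ey u)" for t u
    proof -
      have "L2_inner M (ey t) (y u)
          = L2_inner M (ey t) (\<lambda>\<omega>. (\<Sum>i=1..p. c i * x (u - int i) \<omega>)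
                                   + (\<Sum>i=1..p. b i * y (u - int i) \<omega>) + ey u \<omega>)"
        by (rule L2_inner_cong_AE[OF y_eq]) (intro sq_integrable_intros sq_int)+
      then show ?thesis
        by (simp add: L2_inner_add L2_inner_linear_combination sq_int sq_integrable_intros
            driven_innovation_orthogonal_driver)
    qed
    have IH: "L2_inner M (ey t) (y (u - int i)) = L2_inner M (ey 0) (y (u - t - int i))"
      if "i \<in> {1..p}" for i
      using False that less[of "u - int i"] by (simp add: algebra_simps)
    show ?thesis
      unfolding step[of t u] step[of 0 "u - t"] by (simp add: IH ey_ey)
  qed
qed

text \<open>
  Projecting a backcast error onto the innovations of \<open>y\<close> removes \<open>x\<close> and leaves a combination
  of translates of the impulse response, whose norm is bounded below by reversing time. The index
  \<open>m\<close> belongs to the innovation at time \<open>- m\<close>, so that a later value of \<open>y\<close> is a later entry of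
  the impulse response.
  Square-summability of the impulse response is Bessel's inequality for \<open>y 0\<close>.
\<close>

theorem innovation_variance_le_backcast_error:
  fixes b' c' :: "nat \<Rightarrow> real"
  defines "w \<equiv> (\<lambda>\<omega>. y 0 \<omega> - ((\<Sum>i=1..p. c' i * x (int i) \<omega>) + (\<Sum>i=1..p. b' i * y (int i) \<omega>)))"
  shows "s \<le> L2_inner M w w"
proof (cases "s > 0")
  case False
  then show ?thesis
    using L2_inner_self_nonneg[of M w] by linarith
next
  case True
  define G where "G n = L2_inner M (ey 0) (y n)" for n
  let ?g = "\<lambda>m. G m - (\<Sum>i=1..p. b' i * G (m + int i))"
  have bessel: "(\<Sum>m\<in>F. (L2_inner M (ey (- m)) f)\<^sup>2) \<le> s * L2_inner M f f"
    if "sq_integrable M f" "finite F" for f F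
    by (rule bessel_inequality[OF that(1) _ that(2) True]) (simp_all add: sq_int ey_ey)
  have w: "sq_integrable M w"
    unfolding w_def by (intro sq_integrable_intros sq_int)
  have causal: "G n = 0" if "n < 0" for n
    using that by (simp add: G_def ey_past)
  have G: "L2_inner M (ey (- m)) (y n) = G (m + n)" for m n
    using impulse_response_shift[of "- m" n] by (simp add: G_def add.commute)
  have "sq_integrable (count_space UNIV) G"
    by (rule sq_integrable_count_space_bounded(1)) (use bessel[OF sq_int(2)[of 0]] in \<open>simp add: G\<close>)
  then have "(G 0)\<^sup>2 \<le> L2_inner (count_space UNIV) ?g ?g"
    using causal by (rule causal_sequence_backcast_bound)
  also have "\<dots> \<le> s * L2_inner M w w"
  proof (rule sq_integrable_count_space_bounded(2))
    fix F :: "int set" assume "finite F"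
    have "L2_inner M (ey (- m)) w = ?g m" for m
      unfolding w_def
      by (simp add: L2_inner_add L2_inner_diff L2_inner_linear_combination sq_int sq_integrable_intros
          driven_innovation_orthogonal_driver G)
    then show "(\<Sum>m\<in>F. (?g m)\<^sup>2) \<le> s * L2_inner M w w"
      using bessel[OF w \<open>finite F\<close>] by simp
  qed
  also have "G 0 = s"
  proof -
    have "L2_inner M (ey 0) (y 0)
        = L2_inner M (ey 0) (\<lambda>\<omega>. (\<Sum>i=1..p. c i * x (0 - int i) \<omega>)
                                 + (\<Sum>i=1..p. b i * y (0 - int i) \<omega>) + ey 0 \<omega>)"
      by (rule L2_inner_cong_AE[OF y_eq]) (intro sq_integrable_intros sq_int)+
    then show ?thesis
      by (simp add: L2_inner_add L2_inner_linear_combination sq_int sq_integrable_intros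
          ey_past ey_ey G_def)
  qed
  finally show ?thesis
    using True by (simp add: power2_eq_square)
qed

end

section \<open>From random vectors to their components\<close>

lemma sq_integrable_component:
  fixes u :: "'a \<Rightarrow> real^'n"
  assumes "u \<in> borel_measurable M" "integrable M (\<lambda>\<omega>. (norm (u \<omega>))\<^sup>2)"
  shows "sq_integrable M (\<lambda>\<omega>. u \<omega> $ i)"
  unfolding sq_integrable_def
proof
  show m: "(\<lambda>\<omega>. u \<omega> $ i) \<in> borel_measurable M"
    using assms(1) by (rule measurable_compose)
      (intro borel_measurable_continuous_onI continuous_intros)
  have "(u \<omega> $ i)\<^sup>2 \<le> (norm (u \<omega>))\<^sup>2" for \<omega>
    using component_le_norm_cart[of "u \<omega>" i] by (metis abs_ge_zero power2_abs power_mono)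
  then show "integrable M (\<lambda>\<omega>. (u \<omega> $ i)\<^sup>2)"
    using m by (intro Bochner_Integration.integrable_bound[OF assms(2)]) auto
qed

lemma integrable_vec:
  fixes u :: "'a \<Rightarrow> ('b::euclidean_space)^'n"
  assumes "\<And>i. integrable M (\<lambda>\<omega>. u \<omega> $ i)"
  shows "integrable M u"
proof -
  have eq: "u = (\<lambda>\<omega>. \<Sum>i\<in>UNIV. axis i (u \<omega> $ i))"
    by (auto simp: fun_eq_iff vec_eq_iff axis_def if_distrib cong: if_cong)
  have lin: "bounded_linear (axis i :: 'b \<Rightarrow> 'b^'n)" for i
    by (subst linear_conv_bounded_linear[symmetric]) (auto simp: linear_iff vec_eq_iff axis_def)
  show ?thesis
    by (subst eq) (intro Bochner_Integration.integrable_sum integrable_bounded_linear[OF lin] assms)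
qed

lemma integral_vec_component:
  fixes u :: "'a \<Rightarrow> ('b::euclidean_space)^'n"
  assumes "integrable M u"
  shows "(LINT \<omega>|M. u \<omega>) $ i = (LINT \<omega>|M. u \<omega> $ i)"
  by (rule integral_bounded_linear[OF bounded_linear_vec_nth assms, symmetric])

lemma integral_outer_product_component:
  fixes u :: "'a \<Rightarrow> real^'m" and v :: "'a \<Rightarrow> real^'n"
  assumes "\<And>i. sq_integrable M (\<lambda>\<omega>. u \<omega> $ i)" "\<And>j. sq_integrable M (\<lambda>\<omega>. v \<omega> $ j)"
  shows "(LINT \<omega>|M. outer_product (u \<omega>) (v \<omega>)) $ i $ j
       = L2_inner M (\<lambda>\<omega>. u \<omega> $ i) (\<lambda>\<omega>. v \<omega> $ j)"
proof -
  have entry: "integrable M (\<lambda>\<omega>. outer_product (u \<omega>) (v \<omega>) $ i $ j)" for i j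
    using sq_integrable_mult[OF assms] by (simp add: outer_product_def)
  then have row: "integrable M (\<lambda>\<omega>. outer_product (u \<omega>) (v \<omega>) $ i)" for i
    by (rule integrable_vec)
  then have "integrable M (\<lambda>\<omega>. outer_product (u \<omega>) (v \<omega>))"
    by (rule integrable_vec)
  then show ?thesis
    using row by (simp add: integral_vec_component L2_inner_def outer_product_def)
qed

text \<open>
  The moments here are not centred. They still depend on the lag only, because a constant mean
  shifts every autocovariance by the same amount.
\<close>

lemma second_order_stationary_components:
  fixes z :: "int \<Rightarrow> 'a \<Rightarrow> real^'n"
  assumes "prob_space M" and st: "second_order_stationary M z"
  shows "sq_integrable M (\<lambda>\<omega>. z t \<omega> $ i)"
    and "\<exists>r. \<forall>s t. L2_inner M (\<lambda>\<omega>. z s \<omega> $ i) (\<lambda>\<omega>. z t \<omega> $ j) = r (s - t)"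
proof -
  interpret prob_space M by fact
  show sq: "sq_integrable M (\<lambda>\<omega>. z t \<omega> $ i)" for t i
    using st by (auto simp: second_order_stationary_def intro: sq_integrable_component)
  have one: "sq_integrable M (\<lambda>\<omega>. k)" for k
    by (simp add: sq_integrable_def)
  have int: "integrable M (\<lambda>\<omega>. z t \<omega> $ i)" for t i
    using sq_integrable_mult[OF sq one[of 1]] by simp
  obtain \<mu> C where \<mu>: "\<And>t. (LINT \<omega>|M. z t \<omega>) = \<mu>" and C: "\<And>t h. lagged_cov M z t h = C h"
    using st by (auto simp: second_order_stationary_def)
  have mean: "(LINT \<omega>|M. z t \<omega> $ i) = \<mu> $ i" for t i
    using integral_vec_component[OF integrable_vec[OF int]] \<mu> by metis
  have "L2_inner M (\<lambda>\<omega>. z s \<omega> $ i) (\<lambda>\<omega>. z t \<omega> $ j) = C (s - t) $ i $ j + \<mu> $ i * \<mu> $ j" for s t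
  proof -
    have sqc: "sq_integrable M (\<lambda>\<omega>. (z t \<omega> - \<mu>) $ i)" for t i
      using sq_integrable_diff[OF sq one] by simp
    have "C (s - t) $ i $ j = L2_inner M (\<lambda>\<omega>. (z s \<omega> - \<mu>) $ i) (\<lambda>\<omega>. (z t \<omega> - \<mu>) $ j)"
      using C[of s "s - t"] integral_outer_product_component[OF sqc sqc, of s t i j]
      by (simp add: lagged_cov_def \<mu>)
    also have "\<dots> = (LINT \<omega>|M. z s \<omega> $ i * z t \<omega> $ j - \<mu> $ j * z s \<omega> $ i
                              - \<mu> $ i * z t \<omega> $ j + \<mu> $ i * \<mu> $ j)"
      unfolding L2_inner_def by (rule Bochner_Integration.integral_cong) (auto simp: algebra_simps)
    also have "\<dots> = L2_inner M (\<lambda>\<omega>. z s \<omega> $ i) (\<lambda>\<omega>. z t \<omega> $ j) - \<mu> $ i * \<mu> $ j"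
      using int sq_integrable_mult[OF sq sq] by (simp add: L2_inner_def mean prob_space)
    finally show ?thesis by simp
  qed
  then show "\<exists>r. \<forall>s t. L2_inner M (\<lambda>\<omega>. z s \<omega> $ i) (\<lambda>\<omega>. z t \<omega> $ j) = r (s - t)"
    by (intro exI[of _ "\<lambda>h. C h $ i $ j + \<mu> $ i * \<mu> $ j"]) simp
qed

lemma white_noise_components:
  fixes e :: "int \<Rightarrow> 'a \<Rightarrow> real^'n"
  assumes "prob_space M" and wn: "white_noise M e"
  shows "L2_inner M (\<lambda>\<omega>. e s \<omega> $ i) (\<lambda>\<omega>. e t \<omega> $ j)
       = (if s = t then residual_cov M e $ i $ j else 0)"
proof -
  have st: "second_order_stationary M e"
    using wn by (simp add: white_noise_def)
  note sq = second_order_stationary_components(1)[OF assms(1) st]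
  obtain r where r: "\<And>s t. L2_inner M (\<lambda>\<omega>. e s \<omega> $ i) (\<lambda>\<omega>. e t \<omega> $ j) = r (s - t)"
    using second_order_stationary_components(2)[OF assms(1) st] by metis
  show ?thesis
  proof (cases "s = t")
    case True
    then show ?thesis
      using r[of s t] r[of 0 0] integral_outer_product_component[OF sq sq, of 0 0 i j]
      by (simp add: residual_cov_def)
  next
    case False
    then have "(LINT \<omega>|M. outer_product (e s \<omega>) (e (s - (s - t)) \<omega>)) = 0"
      using wn unfolding white_noise_def by (metis right_minus_eq)
    then show ?thesis
      using False integral_outer_product_component[OF sq sq, of s t i j] by simp
  qed
qed

lemma AE_autoregression_component:
  fixes B :: "nat \<Rightarrow> real^2^2"
  assumes "AE \<omega> in M. v \<omega> = (\<Sum>i=1..p. B i *v u i \<omega>) + w \<omega>"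
  shows "AE \<omega> in M. v \<omega> $ k
    = (\<Sum>i=1..p. B i $ k $ 1 * u i \<omega> $ 1) + (\<Sum>i=1..p. B i $ k $ 2 * u i \<omega> $ 2) + w \<omega> $ k"
  using assms
  by (rule AE_mp) (rule AE_I2, simp add: matrix_vector_mult_def sum_2 sum.distrib)

section \<open>Residual variances under time reversal\<close>

theorem theorem1:
  fixes M :: "'a measure"
    and p :: nat
    and A A' :: "nat \<Rightarrow> real^2^2"
    and z e e' :: "int \<Rightarrow> 'a \<Rightarrow> real^2"
  assumes "prob_space M"
    and "p \<ge> 1"
    and "stable_VAR M p A z e"
    and "time_reversed_VAR M p A' z e'"
    and A1: "\<forall>i\<in>{1..p}. lower_triangular2 (A i)"
    and A2: "diagonal_matrix (residual_cov M e)"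
    and A3: "invertible (cross_cov M z 0)"
  shows "residual_cov M e' $ 1 $ 1 \<le> residual_cov M e $ 1 $ 1 \<and>
         residual_cov M e' $ 2 $ 2 \<ge> residual_cov M e $ 2 $ 2"
proof -
  have st: "second_order_stationary M z" and wn: "white_noise M e" and wn': "white_noise M e'"
    and fwd: "\<And>t. AE \<omega> in M. z t \<omega> = (\<Sum>i=1..p. A i *v z (t - int i) \<omega>) + e t \<omega>"
    and bwd: "\<And>t. AE \<omega> in M. z t \<omega> = (\<Sum>i=1..p. A' i *v z (t + int i) \<omega>) + e' t \<omega>"
    and past: "\<And>t h. h \<ge> 1 \<Longrightarrow> (LINT \<omega>|M. outer_product (e t \<omega>) (z (t - h) \<omega>)) = 0"
    and future: "\<And>t h. h \<ge> 1 \<Longrightarrow> (LINT \<omega>|M. outer_product (e' t \<omega>) (z (t + h) \<omega>)) = 0"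
    using assms(3,4) unfolding stable_VAR_def time_reversed_VAR_def by auto
  have ste: "second_order_stationary M e" and ste': "second_order_stationary M e'"
    using wn wn' by (auto simp: white_noise_def)
  define x y ex ey ex' ey' where "x t \<omega> = z t \<omega> $ 1" and "y t \<omega> = z t \<omega> $ 2"
    and "ex t \<omega> = e t \<omega> $ 1" and "ey t \<omega> = e t \<omega> $ 2"
    and "ex' t \<omega> = e' t \<omega> $ 1" and "ey' t \<omega> = e' t \<omega> $ 2" for t \<omega>
  note defs = x_def y_def ex_def ey_def ex'_def ey'_def
  note sqz = second_order_stationary_components(1)[OF assms(1) st]
  note sqe = second_order_stationary_components(1)[OF assms(1) ste]
  note sqe' = second_order_stationary_components(1)[OF assms(1) ste']
  have sq: "sq_integrable M (x t)" "sq_integrable M (y t)" "sq_integrable M (ex t)"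
    "sq_integrable M (ey t)" "sq_integrable M (ex' t)" "sq_integrable M (ey' t)" for t
    using sqz[of t] sqe[of t] sqe'[of t] unfolding defs by auto
  have past_component: "L2_inner M (\<lambda>\<omega>. e t \<omega> $ i) (\<lambda>\<omega>. z u \<omega> $ j) = 0" if "u < t" for t u i j
    using past[of "t - u" t] that integral_outer_product_component[OF sqe sqz, of t u i j] by simp
  have future_component: "L2_inner M (\<lambda>\<omega>. e' t \<omega> $ i) (\<lambda>\<omega>. z u \<omega> $ j) = 0"
    if "t < u" for t u i j
    using future[of "u - t" t] that integral_outer_product_component[OF sqe' sqz, of t u i j] by simp
  have noise: "L2_inner M (ex t) (ex u) = (if t = u then residual_cov M e $ 1 $ 1 else 0)"
    "L2_inner M (ey t) (ey u) = (if t = u then residual_cov M e $ 2 $ 2 else 0)"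
    "L2_inner M (ex' t) (ex' u) = (if t = u then residual_cov M e' $ 1 $ 1 else 0)"
    "L2_inner M (ey' t) (ey' u) = (if t = u then residual_cov M e' $ 2 $ 2 else 0)" for t u
    unfolding defs using white_noise_components[OF assms(1) wn]
      white_noise_components[OF assms(1) wn'] by simp_all
  have ey_ex: "L2_inner M (ey t) (ex u) = 0" for t u
    using white_noise_components[OF assms(1) wn, of t 2 u 1] A2
    unfolding diagonal_matrix_def defs by auto

  have x_fwd: "AE \<omega> in M. x t \<omega> = (\<Sum>i=1..p. A i $ 1 $ 1 * x (t - int i) \<omega>) + ex t \<omega>" for t
    using AE_autoregression_component[OF fwd[of t], of 1] A1
    by (simp add: defs lower_triangular2_def)
  have y_fwd: "AE \<omega> in M. y t \<omega> = (\<Sum>i=1..p. A i $ 2 $ 1 * x (t - int i) \<omega>)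
      + (\<Sum>i=1..p. A i $ 2 $ 2 * y (t - int i) \<omega>) + ey t \<omega>" for t
    using AE_autoregression_component[OF fwd[of t], of 2] by (simp add: defs)
  have x_bwd: "AE \<omega> in M. x 0 \<omega> = (\<Sum>i=1..p. A' i $ 1 $ 1 * x (int i) \<omega>)
      + (\<Sum>i=1..p. A' i $ 1 $ 2 * y (int i) \<omega>) + ex' 0 \<omega>"
    using AE_autoregression_component[OF bwd[of 0], of 1] by (simp add: defs)
  have y_bwd: "AE \<omega> in M. y 0 \<omega> = (\<Sum>i=1..p. A' i $ 2 $ 1 * x (int i) \<omega>)
      + (\<Sum>i=1..p. A' i $ 2 $ 2 * y (int i) \<omega>) + ey' 0 \<omega>"
    using AE_autoregression_component[OF bwd[of 0], of 2] by (simp add: defs)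

  have "residual_cov M e' $ 1 $ 1 \<le> residual_cov M e $ 1 $ 1"
  proof -
    let ?back = "\<lambda>\<omega>. x 0 \<omega> - (\<Sum>i=1..p. A i $ 1 $ 1 * x (int i) \<omega>)"
    let ?forw = "\<lambda>\<omega>. x 0 \<omega> - (\<Sum>i=1..p. A i $ 1 $ 1 * x (- int i) \<omega>)"
    let ?v = "\<lambda>\<omega>. (\<Sum>i=1..p. (A' i $ 1 $ 1 - A i $ 1 $ 1) * x (int i) \<omega>)
                  + (\<Sum>i=1..p. A' i $ 1 $ 2 * y (int i) \<omega>)"
    obtain r where r: "\<And>s t. L2_inner M (x s) (x t) = r (s - t)"
      using second_order_stationary_components(2)[OF assms(1) st] unfolding x_def by metis
    have sqs: "sq_integrable M ?back" "sq_integrable M ?forw" "sq_integrable M ?v"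
      by (intro sq_integrable_intros sq)+
    \<comment> \<open>\<open>?v\<close> is the difference of the optimal backcast of \<open>x\<close> and the one with the forward
      coefficients. It involves the future only, so it is orthogonal to the reversed residual.\<close>
    have "L2_inner M (ex' 0) (ex' 0) \<le> L2_inner M ?back ?back"
    proof (rule L2_inner_self_le_orthogonal_sum[where v = ?v])
      show "AE \<omega> in M. ?back \<omega> = ex' 0 \<omega> + ?v \<omega>"
        using x_bwd by (rule AE_mp) (auto simp: left_diff_distrib sum_subtractf)
      have "L2_inner M (ex' 0) (x (int i)) = 0" "L2_inner M (ex' 0) (y (int i)) = 0"
        if "i \<in> {1..p}" for i
        using that future_component unfolding defs by auto
      then show "L2_inner M (ex' 0) ?v = 0"
        by (simp add: L2_inner_add L2_inner_linear_combination sq sq_integrable_intros)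
    qed (use sq sqs in auto)
    also have "\<dots> = L2_inner M ?forw ?forw"
      by (rule prediction_error_time_reversal[where f = x]) (rule sq, rule r)
    also have "\<dots> = L2_inner M (ex 0) (ex 0)"
    proof -
      have ae: "AE \<omega> in M. ?forw \<omega> = ex 0 \<omega>"
        using x_fwd[of 0] by (rule AE_mp) auto
      show ?thesis
        using L2_inner_cong_AE[OF ae sqs(2) sqs(2) sq(3)] L2_inner_cong_AE[OF ae sq(3) sqs(2) sq(3)]
        by (simp add: L2_inner_commute)
    qed
    finally show ?thesis
      by (simp add: noise)
  qed

  moreover have "residual_cov M e $ 2 $ 2 \<le> residual_cov M e' $ 2 $ 2"
  proof -
    interpret driven_pair M p "\<lambda>i. A i $ 1 $ 1" "\<lambda>i. A i $ 2 $ 2" "\<lambda>i. A i $ 2 $ 1" x y ex ey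
      "residual_cov M e $ 2 $ 2"
    proof (standard, goal_cases)
      case (9 t u)
      then show ?case using past_component unfolding defs by auto
    next
      case (10 t u)
      then show ?case using past_component unfolding defs by auto
    qed (use sq x_fwd y_fwd ey_ex noise(2) in auto)
    let ?w = "\<lambda>\<omega>. y 0 \<omega> - ((\<Sum>i=1..p. A' i $ 2 $ 1 * x (int i) \<omega>)
                            + (\<Sum>i=1..p. A' i $ 2 $ 2 * y (int i) \<omega>))"
    have w: "sq_integrable M ?w"
      by (intro sq_integrable_intros sq)
    have ae: "AE \<omega> in M. ?w \<omega> = ey' 0 \<omega>"
      using y_bwd by (rule AE_mp) auto
    have "residual_cov M e $ 2 $ 2 \<le> L2_inner M ?w ?w"
      by (rule innovation_variance_le_backcast_error)
    also have "\<dots> = L2_inner M (ey' 0) (ey' 0)"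
      using L2_inner_cong_AE[OF ae w w sq(6)] L2_inner_cong_AE[OF ae sq(6) w sq(6)]
      by (simp add: L2_inner_commute)
    finally show ?thesis
      by (simp add: noise)
  qed
  ultimately show ?thesis by simp
qed

end
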